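(* Let $W$ be a finite-dimensional complex vector space with a positive-definite Hermitian form, $\dim_{\mathbb C}W=m$ (with $m=0$ allowed), let $D\in\mathrm U(W)$, and let $p,c\in\mathbb T$. Define $\rho_c(\zeta)=c^2/\zeta$. Then the following conditions are equivalent: (i) $p^2\det D=c^{2(m+1)}$; (ii) there exist $F\in\mathrm U(W)$ and a unitary involution $K_W\in\mathrm U(W)$ (that is, $K_W^2=\mathrm I$) such that $F^2=D$ and the multiset $\{p\}\sqcup\operatorname{spec}(FK_W)$ is invariant under $\rho_c$.
   Context: $\mathbb T=\{z\in\mathbb C:|z|=1\}$. $\mathrm U(W)$ is the unitary group of $W$. $\operatorname{spec}(A)$ denotes the multiset of eigenvalues of $A$ counted with algebraic multiplicity, and $\sqcup$ is multiset union with multiplicities retained; invariance of a multiset under $\rho_c$ is meant with multiplicities. A unitary involution is a unitary operator $K$ with $K^2=\mathrm I$ ($K=\pm\mathrm I$ allowed). If $W=\{0\}$, the determinant of its identity map is $1$ and its spectrum is the empty multiset. *)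

theory Defs
  imports Complex_Main "HOL-Library.Multiset" "Jordan_Normal_Form.Char_Poly"
begin

text \<open>
  The space is the whole type \<open>'a\<close>, so that it is the zero space when \<open>'a\<close> has a single element.
  The form is linear in its first argument; by conjugate symmetry it is conjugate-linear in the
  second one.
\<close>

locale hermitian_space = vector_space scale
  for scale :: "complex \<Rightarrow> 'a::ab_group_add \<Rightarrow> 'a" (infixr "*s" 75) +
  fixes herm :: "'a \<Rightarrow> 'a \<Rightarrow> complex"
  assumes finite_dimensional: "\<exists>B. finite B \<and> span B = UNIV"
    and herm_add: "herm (x + y) z = herm x z + herm y z"
    and herm_scale: "herm (r *s x) z = r * herm x z"
    and herm_sym: "herm y x = cnj (herm x y)"
    and herm_pos: "x \<noteq> 0 \<Longrightarrow> herm x x \<in> \<real> \<and> Re (herm x x) > 0"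
begin

definition unitary_group :: "('a \<Rightarrow> 'a) set" where
  "unitary_group =
     {A. Vector_Spaces.linear scale scale A \<and> bij A \<and> (\<forall>x y. herm (A x) (A y) = herm x y)}"

definition ordered_basis :: "'a list \<Rightarrow> bool" where
  "ordered_basis bs \<longleftrightarrow> distinct bs \<and> independent (set bs) \<and> span (set bs) = UNIV"

text \<open>\<open>matrix_of bs cs A\<close>: coordinates with respect to \<open>cs\<close> of the images of the vectors of \<open>bs\<close>.\<close>

definition matrix_of :: "'a list \<Rightarrow> 'a list \<Rightarrow> ('a \<Rightarrow> 'a) \<Rightarrow> complex mat" where
  "matrix_of bs cs A =
     mat (length cs) (length bs) (\<lambda>(i, j). representation (set cs) (A (bs ! j)) (cs ! i))"

text \<open>
  The determinant and the characteristic polynomial of an endomorphism are those of its matrix in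
  any ordered basis; the choice made here is irrelevant by \<open>op_det_eq\<close> and \<open>op_char_poly_eq\<close> below.
\<close>

definition some_basis :: "'a list" where
  "some_basis = (SOME bs. ordered_basis bs)"

definition op_det :: "('a \<Rightarrow> 'a) \<Rightarrow> complex" where
  "op_det A = Determinant.det (matrix_of some_basis some_basis A)"

definition op_char_poly :: "('a \<Rightarrow> 'a) \<Rightarrow> complex poly" where
  "op_char_poly A = char_poly (matrix_of some_basis some_basis A)"

definition op_spec :: "('a \<Rightarrow> 'a) \<Rightarrow> complex multiset" where
  "op_spec A = proots (op_char_poly A)"

lemma ordered_basis_exists: "\<exists>bs. ordered_basis bs"
proof -
  obtain S where S: "finite S" "span S = UNIV"
    using finite_dimensional by blast
  obtain B where B: "B \<subseteq> S" "independent B" "S \<subseteq> span B"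
    using maximal_independent_subset[of S] by blast
  have "span B = UNIV"
    using S(2) B(3) span_minimal[OF B(3) subspace_span] by auto
  moreover have "finite B"
    using S(1) B(1) finite_subset by blast
  ultimately show ?thesis
    using B(2) finite_distinct_list[of B] unfolding ordered_basis_def by metis
qed

lemma ordered_basis_some_basis: "ordered_basis some_basis"
  unfolding some_basis_def using ordered_basis_exists by (rule someI_ex)

lemma length_ordered_basis:
  assumes "ordered_basis bs"
  shows "length bs = dim UNIV"
proof -
  have "dim UNIV = card (set bs)"
    using assms dim_eq_card[of "set bs" UNIV] by (auto simp: ordered_basis_def)
  thus ?thesis
    using assms by (simp add: ordered_basis_def distinct_card)
qed

lemma sum_ordered_basis:
  assumes "ordered_basis bs"
  shows "(\<Sum>i<length bs. representation (set bs) v (bs ! i) *s (bs ! i)) = v"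
proof -
  have "bij_betw (\<lambda>i. bs ! i) {..<length bs} (set bs)"
    using assms by (intro bij_betw_nth) (auto simp: ordered_basis_def)
  hence "(\<Sum>i<length bs. representation (set bs) v (bs ! i) *s (bs ! i)) =
         (\<Sum>b\<in>set bs. representation (set bs) v b *s b)"
    by (rule sum.reindex_bij_betw)
  also have "\<dots> = v"
    using assms by (intro sum_representation_eq) (auto simp: ordered_basis_def)
  finally show ?thesis .
qed

lemma matrix_of_carrier:
  assumes "ordered_basis bs" "ordered_basis cs"
  shows "matrix_of bs cs A \<in> carrier_mat (dim UNIV) (dim UNIV)"
  using assms by (simp add: matrix_of_def length_ordered_basis)

lemma matrix_of_id:
  assumes "ordered_basis bs"
  shows "matrix_of bs bs id = 1\<^sub>m (dim UNIV)"
proof -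
  have *: "representation (set bs) (bs ! j) (bs ! i) = (if i = j then 1 else 0)"
    if "i < length bs" "j < length bs" for i j
    using assms that representation_basis[of "set bs" "bs ! j"]
    by (auto simp: ordered_basis_def nth_eq_iff_index_eq)
  show ?thesis
    by (rule eq_matI) (auto simp: matrix_of_def * length_ordered_basis[OF assms, symmetric])
qed

lemma matrix_of_comp:
  assumes bs: "ordered_basis bs" and cs: "ordered_basis cs" and ds: "ordered_basis ds"
    and lin: "Vector_Spaces.linear scale scale A"
  shows "matrix_of bs ds (A \<circ> B) = matrix_of cs ds A * matrix_of bs cs B"
proof (rule eq_matI)
  interpret A: Vector_Spaces.linear scale scale A by (rule lin)
  let ?R = "representation (set ds)" and ?S = "representation (set cs)"
  fix i j
  assume "i < dim_row (matrix_of cs ds A * matrix_of bs cs B)"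
    and "j < dim_col (matrix_of cs ds A * matrix_of bs cs B)"
  hence i: "i < length ds" and j: "j < length bs"
    by (auto simp: matrix_of_def)
  have ind: "independent (set ds)" "span (set ds) = UNIV"
    using ds by (auto simp: ordered_basis_def)
  have "A (B (bs ! j)) = A (\<Sum>k<length cs. ?S (B (bs ! j)) (cs ! k) *s (cs ! k))"
    by (simp only: sum_ordered_basis[OF cs])
  also have "\<dots> = (\<Sum>k<length cs. ?S (B (bs ! j)) (cs ! k) *s A (cs ! k))"
    by (simp add: A.sum A.scale)
  finally have "?R (A (B (bs ! j))) (ds ! i) =
      (\<Sum>k<length cs. ?S (B (bs ! j)) (cs ! k) * ?R (A (cs ! k)) (ds ! i))"
    using ind by (simp add: representation_sum representation_scale)
  thus "matrix_of bs ds (A \<circ> B) $$ (i, j) = (matrix_of cs ds A * matrix_of bs cs B) $$ (i, j)"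
    using i j by (simp add: matrix_of_def scalar_prod_def mult.commute atLeast0LessThan)
qed (auto simp: matrix_of_def)

lemma matrix_of_similar:
  assumes bs: "ordered_basis bs" and cs: "ordered_basis cs"
    and lin: "Vector_Spaces.linear scale scale A"
  shows "similar_mat (matrix_of bs bs A) (matrix_of cs cs A)"
proof (rule similar_matI)
  have id: "Vector_Spaces.linear scale scale id"
    using linear_id by (simp add: id_def)
  show "{matrix_of bs bs A, matrix_of cs cs A, matrix_of cs bs id, matrix_of bs cs id}
          \<subseteq> carrier_mat (dim UNIV) (dim UNIV)"
    using matrix_of_carrier bs cs by blast
  show "matrix_of cs bs id * matrix_of bs cs id = 1\<^sub>m (dim UNIV)"
    using matrix_of_comp[OF bs cs bs id, of id] matrix_of_id[OF bs] by simp
  show "matrix_of bs cs id * matrix_of cs bs id = 1\<^sub>m (dim UNIV)"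
    using matrix_of_comp[OF cs bs cs id, of id] matrix_of_id[OF cs] by simp
  show "matrix_of bs bs A = matrix_of cs bs id * matrix_of cs cs A * matrix_of bs cs id"
    using matrix_of_comp[OF cs cs bs id, of A] matrix_of_comp[OF bs cs bs lin, of id] by simp
qed

lemma op_det_eq:
  assumes "ordered_basis bs" "Vector_Spaces.linear scale scale A"
  shows "op_det A = Determinant.det (matrix_of bs bs A)"
  unfolding op_det_def
  using det_similar[OF matrix_of_similar[OF ordered_basis_some_basis assms]] .

lemma op_char_poly_eq:
  assumes "ordered_basis bs" "Vector_Spaces.linear scale scale A"
  shows "op_char_poly A = char_poly (matrix_of bs bs A)"
  unfolding op_char_poly_def
  using char_poly_similar[OF matrix_of_similar[OF ordered_basis_some_basis assms]] .

end

text \<open>Only used at nonzero \<open>\<zeta>\<close>, so the totalised division plays no role.\<close>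

definition rho :: "complex \<Rightarrow> complex \<Rightarrow> complex" where
  "rho c \<zeta> = c\<^sup>2 / \<zeta>"

definition invariant_mset :: "('b \<Rightarrow> 'b) \<Rightarrow> 'b multiset \<Rightarrow> bool" where
  "invariant_mset f M \<longleftrightarrow> image_mset f M = M"

end

theory Submission
  imports Defs
begin

text \<open>
  Throughout, \<open>F\<close> is the square root of \<open>D\<close>, \<open>K\<close> the involution, and \<open>\<rho>(\<zeta>) = c\<^sup>2 / \<zeta>\<close>.

  The determinant condition is necessary because \<open>\<rho>\<close> turns the product \<open>P\<close> of a multiset of \<open>m + 1\<close>
  nonzero numbers into \<open>c\<^bsup>2(m+1)\<^esup> / P\<close>; an invariant multiset therefore has \<open>P\<^sup>2 = c\<^bsup>2(m+1)\<^esup>\<close>, and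
  here \<open>P = p det(F) det(K)\<close>, where \<open>det(F)\<^sup>2 = det(D)\<close> and \<open>det(K)\<^sup>2 = 1\<close>.

  Conversely, in an orthonormal eigenbasis \<open>D\<close> is \<open>diag(d\<^sub>0, d\<^sub>1, ...)\<close>, and the eigenvalues are used up
  two at a time. The key fact concerns \<open>2 \<times> 2\<close> matrices (\<open>reflection_coefficient\<close>): for any
  \<open>x\<close> on the unit circle there are square roots \<open>f, g\<close> of \<open>d\<^sub>0, d\<^sub>1\<close> and a real reflection \<open>R\<close> such that
  \<open>diag(f, g) R\<close> has the eigenvalue \<open>x\<close>. Geometrically, \<open>x\<close> is an eigenvalue as soon as \<open>R\<close>
  carries \<open>v\<close> to \<open>x diag(f, g)\<^sup>-\<^sup>1 v\<close> for some \<open>v \<noteq> 0\<close>, and a unitary involution exchanging two vectors of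
  equal length exists exactly when their inner product is real. That inner product is a convex
  combination of \<open>f / x\<close> and \<open>g / x\<close> up to conjugation, and it can be made real once the signs of the
  roots put these two numbers on opposite sides of the real axis.

  Taking \<open>x = \<rho>(p)\<close> gives \<open>p\<close> its partner. The other eigenvalue of the block is \<open>q = - f g / x\<close>, which
  needs a partner in turn; since \<open>q\<^sup>2 = d\<^sub>0 d\<^sub>1 p\<^sup>2 / c\<^sup>4\<close>, the number \<open>q\<close> satisfies the determinant condition
  for the remaining eigenvalues \<open>d\<^sub>2, d\<^sub>3, ...\<close>, and induction applies
  (\<open>diagonal_square_root_times_involution\<close>). The process ends either with nothing left and \<open>p\<^sup>2 = c\<^sup>2\<close>,
  so that \<open>p\<close> is its own partner, or with a single \<open>d\<^sub>0 = \<rho>(p)\<^sup>2\<close>, where \<open>F = \<rho>(p)\<close> and \<open>K = 1\<close> work.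
\<close>

section \<open>A reflection prescribing one eigenvalue of a two-dimensional block\<close>

text \<open>
  The equation says that \<open>1\<close> is an eigenvalue of \<open>diag(g, h) R\<close>, where \<open>R\<close> is the reflection with rows
  \<open>(k, l)\<close> and \<open>(l, - k)\<close>; it is linear in \<open>k\<close>. If \<open>g \<noteq> h\<close>, its solution
  \<open>(1 - g h) / (g - h)\<close> equals its own conjugate because \<open>g\<close> and \<open>h\<close> have modulus \<open>1\<close>, and comparing \<open>\<bar>1 - g h\<bar>\<^sup>2\<close> with \<open>\<bar>g - h\<bar>\<^sup>2\<close> shows that it
  lies in \<open>[-1, 1]\<close> exactly when \<open>Im g\<close> and \<open>Im h\<close> do not have the same strict sign.
\<close>

lemma reflection_coefficient_at_one:
  fixes g h :: complex
  assumes g: "cmod g = 1" and h: "cmod h = 1" and signs: "Im g \<ge> 0" "Im h \<le> 0"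
  shows "\<exists>k::real. \<bar>k\<bar> \<le> 1 \<and> 1 - of_real k * (g - h) - g * h = 0"
proof (cases "g = h")
  case True
  \<comment> \<open>Both numbers are then the same sign \<open>\<plusminus> 1\<close>, and the equation holds for every \<open>k\<close>.\<close>
  with signs have "Im g = 0" by simp
  with g have "(Re g)\<^sup>2 = 1"
    using cmod_power2[of g] by simp
  with \<open>Im g = 0\<close> have "g\<^sup>2 = 1"
    by (simp add: complex_eq_iff power2_eq_square)
  with True show ?thesis
    by (intro exI[of _ 1]) (simp add: power2_eq_square)
next
  case False
  define z where "z = (1 - g * h) / (g - h)"
  have unit: "g * cnj g = 1" "h * cnj h = 1"
    using g h by (simp_all add: complex_norm_square[symmetric])
  hence inv: "cnj g = inverse g" "cnj h = inverse h" and nz: "g \<noteq> 0" "h \<noteq> 0"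
    by (auto simp: inverse_unique)
  have "cnj z = z"
    using False nz by (simp add: z_def inv divide_simps) (simp add: algebra_simps)
  hence z: "of_real (Re z) = z"
    by (simp add: complex_eq_iff)
  have "(cmod (1 - g * h))\<^sup>2 = 1 - 2 * Re (g * h) + (cmod (g * h))\<^sup>2"
    unfolding cmod_power2 by (simp add: power2_eq_square algebra_simps)
  moreover have "(cmod (g - h))\<^sup>2 = (cmod g)\<^sup>2 - 2 * (Re g * Re h + Im g * Im h) + (cmod h)\<^sup>2"
    unfolding cmod_power2 by (simp add: power2_eq_square algebra_simps)
  moreover have "Im g * Im h \<le> 0"
    using signs by (rule mult_nonneg_nonpos)
  ultimately have "(cmod (1 - g * h))\<^sup>2 \<le> (cmod (g - h))\<^sup>2"
    using g h by (simp add: norm_mult)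
  hence "cmod (1 - g * h) \<le> cmod (g - h)"
    by (rule power2_le_imp_le) simp
  hence "cmod z \<le> 1"
    using False by (simp add: z_def norm_divide)
  hence "\<bar>Re z\<bar> \<le> 1"
    using abs_Re_le_cmod order_trans by blast
  moreover have "1 - z * (g - h) - g * h = 0"
    using False by (simp add: z_def)
  ultimately show ?thesis
    using z by metis
qed

text \<open>
  The last equation is the characteristic equation of \<open>diag(f, g) R\<close> at \<open>x\<close>, with the reflection \<open>R\<close> as
  above. Dividing \<open>f\<close> and \<open>g\<close> by \<open>x\<close> reduces to the eigenvalue \<open>1\<close>. Each of \<open>d / x\<^sup>2\<close> and \<open>e / x\<^sup>2\<close> has a square root in
  the closed upper half plane; negating the second one puts the two roots on opposite sides.
\<close>

lemma reflection_coefficient: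
  fixes d e x :: complex
  assumes "cmod d = 1" "cmod e = 1" "cmod x = 1"
  obtains f g :: complex and k l :: real
  where "f\<^sup>2 = d" "g\<^sup>2 = e" "k\<^sup>2 + l\<^sup>2 = 1" "x\<^sup>2 - of_real k * (f - g) * x - f * g = 0"
proof -
  have root: "\<exists>u. u\<^sup>2 = w \<and> cmod u = 1 \<and> Im u \<ge> 0" if "cmod w = 1" for w
  proof -
    obtain u where u: "u\<^sup>2 = w" using power2_csqrt by blast
    have "(cmod u)\<^sup>2 = 1"
      using that u by (simp add: norm_power[symmetric])
    hence "cmod u = 1"
      using norm_ge_zero[of u] by (auto simp: power2_eq_1_iff)
    thus ?thesis using u
      by (cases "Im u \<ge> 0") (auto intro: exI[of _ u] exI[of _ "-u"])
  qed
  have x0: "x \<noteq> 0" using assms(3) by auto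
  obtain u where u: "u\<^sup>2 = d / x\<^sup>2" "cmod u = 1" "Im u \<ge> 0"
    using root[of "d / x\<^sup>2"] assms by (auto simp: norm_divide norm_power)
  obtain v where v: "v\<^sup>2 = e / x\<^sup>2" "cmod v = 1" "Im v \<ge> 0"
    using root[of "e / x\<^sup>2"] assms by (auto simp: norm_divide norm_power)
  obtain k :: real where k: "\<bar>k\<bar> \<le> 1" "1 - of_real k * (u - - v) - u * - v = 0"
    using reflection_coefficient_at_one[of u "-v"] u v by auto
  show thesis
  proof (rule that[of "x * u" "x * - v" k "sqrt (1 - k\<^sup>2)"])
    show "(x * u)\<^sup>2 = d" "(x * - v)\<^sup>2 = e"
      using x0 u v by (simp_all add: power_mult_distrib)
    show "k\<^sup>2 + (sqrt (1 - k\<^sup>2))\<^sup>2 = 1"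
      using k(1) by (simp add: abs_square_le_1)
    have "x\<^sup>2 - of_real k * (x * u - x * - v) * x - x * u * (x * - v)
        = x\<^sup>2 * (1 - of_real k * (u - - v) - u * - v)"
      by (simp add: power2_eq_square algebra_simps)
    thus "x\<^sup>2 - of_real k * (x * u - x * - v) * x - x * u * (x * - v) = 0"
      using k(2) by simp
  qed
qed

section \<open>Characteristic polynomials of block matrices\<close>

lemma char_poly_four_block_diag:
  fixes A B :: "'a :: idom mat"
  assumes "A \<in> carrier_mat m m" "B \<in> carrier_mat n n"
  shows "char_poly (four_block_mat A (0\<^sub>m m n) (0\<^sub>m n m) B) = char_poly A * char_poly B"
proof -
  have "char_poly_matrix (four_block_mat A (0\<^sub>m m n) (0\<^sub>m n m) B) =
    four_block_mat (char_poly_matrix A) (0\<^sub>m m n) (0\<^sub>m n m) (char_poly_matrix B)"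
    using assms by (intro eq_matI) (auto simp: char_poly_matrix_def)
  thus ?thesis
    using assms unfolding char_poly_def
    by (simp add: det_four_block_mat_lower_left_zero[of _ m _ n])
qed

lemma det_2x2:
  fixes A :: "'a :: comm_ring_1 mat"
  assumes A: "A \<in> carrier_mat 2 2"
  shows "det A = A $$ (0,0) * A $$ (1,1) - A $$ (0,1) * A $$ (1,0)"
proof -
  have "det A = (\<Sum>j<2. A $$ (0,j) * cofactor A 0 j)"
    by (rule laplace_expansion_row[OF A]) simp
  also have "\<dots> = A $$ (0,0) * A $$ (1,1) - A $$ (0,1) * A $$ (1,0)"
    using A by (simp add: numeral_2_eq_2 cofactor_def mat_delete_def det_single[unfolded One_nat_def])
  finally show ?thesis .
qed

lemma char_poly_2x2:
  fixes A :: "'a :: comm_ring_1 mat"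
  assumes "A \<in> carrier_mat 2 2"
  shows "char_poly A =
    [:A $$ (0,0) * A $$ (1,1) - A $$ (0,1) * A $$ (1,0), - (A $$ (0,0) + A $$ (1,1)), 1:]"
  unfolding char_poly_def
  by (subst det_2x2) (use assms in \<open>auto simp: char_poly_matrix_def algebra_simps\<close>)

text \<open>
  The characteristic polynomial splits over the complex numbers; evaluating it at \<open>0\<close> gives both
  \<open>det (- A)\<close> and the product of the negated eigenvalues.
\<close>

lemma prod_mset_proots_char_poly:
  fixes A :: "complex mat"
  assumes A: "A \<in> carrier_mat n n"
  shows "prod_mset (proots (char_poly A)) = det A"
proof -
  obtain as where as: "char_poly A = (\<Prod>a\<leftarrow>as. [:- a, 1:])" "length as = n"
    using char_poly_factorized[OF A] by blast
  have "poly (char_poly A) 0 = det (- char_matrix A 0)"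
    using A by (rule char_poly_matrix)
  also have "- char_matrix A 0 = (- 1) \<cdot>\<^sub>m A"
    using A by (intro eq_matI) (auto simp: char_matrix_def)
  also have "det \<dots> = (- 1) ^ n * det A"
    using A by simp
  finally have "(\<Prod>a\<leftarrow>as. - a) = (- 1) ^ n * det A"
    by (simp add: as(1) poly_prod_list o_def)
  moreover have "(\<Prod>a\<leftarrow>as. - a) = (- 1) ^ length as * prod_list as"
    by (induction as) auto
  moreover have "proots (\<Prod>a\<leftarrow>as. [:- a, 1:]) = mset as"
  proof (induction as)
    case (Cons a as)
    have "(\<Prod>a\<leftarrow>as. [:- a, 1:]) \<noteq> 0" by (auto simp: prod_list_zero_iff)
    hence "proots ([:- a, 1:] * (\<Prod>a\<leftarrow>as. [:- a, 1:])) = {#a#} + mset as"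
      using Cons by (subst proots_mult) simp_all
    thus ?case by simp
  qed simp
  ultimately show ?thesis
    by (simp add: as prod_mset_prod_list)
qed

section \<open>The matrix construction\<close>

text \<open>
  The induction removes two diagonal entries at a time. It carries \<open>p\<close> along as a variable, because the
  eigenvalue of the split-off block that is left without a partner takes over the role of \<open>p\<close>. The
  involution is self-adjoint, which together with \<open>K\<^sup>2 = 1\<close> makes it unitary.
\<close>

lemma diagonal_square_root_times_involution:
  fixes d :: "nat \<Rightarrow> complex"
  assumes "\<And>i. i < n \<Longrightarrow> cmod (d i) = 1" and "cmod p = 1" and "cmod c = 1"
    and "p\<^sup>2 * (\<Prod>i<n. d i) = c ^ (2 * (n + 1))"
  shows "\<exists>f K. (\<forall>i<n. (f i)\<^sup>2 = d i) \<and> K \<in> carrier_mat n n \<and> K * K = 1\<^sub>m n \<and>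
    (\<forall>i<n. \<forall>j<n. K $$ (i, j) = cnj (K $$ (j, i))) \<and>
    invariant_mset (rho c) ({#p#} + proots (char_poly (mat_diag n f * K)))"
  using assms
proof (induction n arbitrary: p d rule: induct_nat_012)
  case 0
  have "p \<noteq> 0" using 0 by auto
  moreover have "p\<^sup>2 = c\<^sup>2" using 0(4) by simp
  ultimately have "rho c p = p" by (simp add: rho_def field_simps power2_eq_square)
  moreover have "char_poly (mat_diag 0 (\<lambda>_. 1) * 1\<^sub>m 0 :: complex mat) = 1"
    by (simp add: char_poly_def)
  ultimately show ?case
    by (intro exI[of _ "\<lambda>_. 1"] exI[of _ "1\<^sub>m 0"]) (simp add: invariant_mset_def)
next
  case 1
  have nz: "p \<noteq> 0" "c \<noteq> 0" using 1 by auto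
  define x where "x = c\<^sup>2 / p"
  have rho: "rho c p = x" "rho c x = p"
    using nz by (simp_all add: rho_def x_def)
  have "x\<^sup>2 = d 0"
    using 1(4) nz by (simp add: x_def field_simps eval_nat_numeral)
  moreover have "char_poly (mat_diag (Suc 0) (\<lambda>_. x) * 1\<^sub>m (Suc 0) :: complex mat) = [:- x, 1:]"
    by (subst char_poly_upper_triangular[of _ 1]) (auto simp: mat_diag_def diag_mat_def)
  ultimately show ?case
    by (intro exI[of _ "\<lambda>_. x"] exI[of _ "1\<^sub>m (Suc 0)"]) (simp add: invariant_mset_def rho)
next
  case (ge2 n)
  have nz: "p \<noteq> 0" "c \<noteq> 0" using ge2.prems by auto
  define x where "x = c\<^sup>2 / p"
  have x: "cmod x = 1" "x \<noteq> 0"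
    using ge2.prems nz by (auto simp: x_def norm_divide norm_power)
  have rho: "rho c p = x" "rho c x = p"
    using nz by (simp_all add: rho_def x_def)
  have d01: "cmod (d 0) = 1" "cmod (d 1) = 1"
    using ge2.prems(1) by simp_all
  obtain f g :: complex and k l :: real where fg: "f\<^sup>2 = d 0" "g\<^sup>2 = d 1"
    and kl: "k\<^sup>2 + l\<^sup>2 = 1" and root: "x\<^sup>2 - of_real k * (f - g) * x - f * g = 0"
    by (rule reflection_coefficient[OF d01 x(1)])
  \<comment> \<open>A reflection has determinant \<open>- 1\<close>, so the product of the block's eigenvalues is \<open>- f g\<close>.\<close>
  define q where "q = - f * g / x"
  have q: "q\<^sup>2 = d 0 * d 1 / x\<^sup>2"
    by (simp add: q_def power_divide power_mult_distrib fg)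
  have "(cmod q)\<^sup>2 = 1"
    using arg_cong[OF q, of cmod] x d01 by (simp add: norm_divide norm_mult norm_power)
  hence q1: "cmod q = 1"
    using norm_ge_zero[of q] by (auto simp: power2_eq_1_iff)
  have "(\<Prod>i<Suc (Suc n). d i) = d 0 * d 1 * (\<Prod>i<n. d (i + 2))"
    by (simp add: prod.lessThan_Suc_shift del: prod.lessThan_Suc)
  hence "q\<^sup>2 * (\<Prod>i<n. d (i + 2)) = p\<^sup>2 * (\<Prod>i<Suc (Suc n). d i) / c ^ 4"
    using nz by (simp add: q x_def field_simps)
  also have "\<dots> = c ^ (2 * (n + 1))"
    unfolding ge2.prems(4) using nz by (simp add: field_simps eval_nat_numeral)
  finally have budget: "q\<^sup>2 * (\<Prod>i<n. d (i + 2)) = c ^ (2 * (n + 1))" .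
  have "cmod (d (i + 2)) = 1" if "i < n" for i
    using ge2.prems(1)[of "i + 2"] that by simp
  from ge2.IH(1)[of "\<lambda>i. d (i + 2)", OF this q1 ge2.prems(3) budget]
  obtain f' K' where f': "\<And>i. i < n \<Longrightarrow> (f' i)\<^sup>2 = d (i + 2)"
    and K': "K' \<in> carrier_mat n n" "K' * K' = 1\<^sub>m n"
    and herm': "\<And>i j. i < n \<Longrightarrow> j < n \<Longrightarrow> K' $$ (i, j) = cnj (K' $$ (j, i))"
    and inv: "invariant_mset (rho c) ({#q#} + proots (char_poly (mat_diag n f' * K')))"
    by blast
  define R :: "complex mat" where
    "R = mat 2 2 (\<lambda>(i, j). if i \<noteq> j then of_real l else if i = 0 then of_real k else - of_real k)"
  define K where "K = four_block_mat R (0\<^sub>m 2 n) (0\<^sub>m n 2) K'"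
  define F where "F = (\<lambda>i. if i = 0 then f else if i = 1 then g else f' (i - 2))"
  have R: "R \<in> carrier_mat 2 2" by (simp add: R_def)
  have "K \<in> carrier_mat (2 + n) (2 + n)"
    unfolding K_def using R K'(1) by (rule four_block_carrier_mat)
  hence K: "K \<in> carrier_mat (Suc (Suc n)) (Suc (Suc n))" by simp
  have FK': "mat_diag n f' * K' \<in> carrier_mat n n"
    using mat_diag_dim K'(1) by (rule mult_carrier_mat)
  have FR: "mat_diag 2 F * R \<in> carrier_mat 2 2"
    using mat_diag_dim R by (rule mult_carrier_mat)
  have kl': "complex_of_real k * of_real k + of_real l * of_real l = 1"
    using arg_cong[OF kl, of complex_of_real] by (simp add: power2_eq_square)
  have R2: "R * R = 1\<^sub>m 2"
    using kl' by (intro eq_matI)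
      (auto simp: R_def scalar_prod_def numeral_2_eq_2 less_Suc_eq add.commute)
  have "char_poly (mat_diag 2 F * R) = [:- x, 1:] * [:- q, 1:]"
  proof -
    have "x * q = - (f * g)" using x by (simp add: q_def)
    moreover have "x + q = of_real k * (f - g)"
      using root x by (simp add: q_def field_simps power2_eq_square)
    moreover have "f * g = (complex_of_real k * of_real k + of_real l * of_real l) * f * g"
      by (simp add: kl')
    moreover have "mat_diag 2 F * R = mat 2 2 (\<lambda>(i, j). F i * R $$ (i, j))"
      by (rule mat_diag_mult_left[OF R])
    ultimately show ?thesis
      by (simp add: char_poly_2x2 R_def F_def algebra_simps)
  qed
  moreover have "mat_diag (Suc (Suc n)) F * K =
      four_block_mat (mat_diag 2 F * R) (0\<^sub>m 2 n) (0\<^sub>m n 2) (mat_diag n f' * K')"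
  proof -
    show ?thesis using R K' K
      by (intro eq_matI)
        (auto simp: mat_diag_mult_left[of _ "Suc (Suc n)" "Suc (Suc n)"] mat_diag_mult_left[of _ 2 2] mat_diag_mult_left[of _ n n] F_def K_def)
  qed
  moreover have "char_poly (mat_diag n f' * K') \<noteq> 0"
    using degree_monic_char_poly[OF FK'] by auto
  moreover have "proots ([:- x, 1:] * [:- q, 1:]) = {#x, q#}"
    by (subst proots_mult) simp_all
  ultimately have roots: "proots (char_poly (mat_diag (Suc (Suc n)) F * K)) =
      {#x#} + ({#q#} + proots (char_poly (mat_diag n f' * K')))"
    using char_poly_four_block_diag[OF FR FK'] by (simp add: proots_mult del: mult_pCons_left)
  show ?case
  proof (intro exI[of _ F] exI[of _ K] conjI allI impI)
    show "(F i)\<^sup>2 = d i" if "i < Suc (Suc n)" for i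
    proof (cases "i < 2")
      case True
      thus ?thesis using fg by (auto simp: F_def less_2_cases_iff)
    next
      case False
      then obtain j where "i = j + 2" by (metis le_add_diff_inverse2 linorder_not_less)
      thus ?thesis using that f'[of j] by (simp add: F_def)
    qed
    show "K \<in> carrier_mat (Suc (Suc n)) (Suc (Suc n))"
      by (rule K)
    show "K * K = 1\<^sub>m (Suc (Suc n))"
      using R K' R2 unfolding K_def
      by (subst mult_four_block_mat[of _ 2 2 _ n _ n]) auto
    show "K $$ (i, j) = cnj (K $$ (j, i))" if "i < Suc (Suc n)" "j < Suc (Suc n)" for i j
      using that R K' herm'[of "i - 2" "j - 2"] by (auto simp: K_def R_def)
    show "invariant_mset (rho c) ({#p#} + proots (char_poly (mat_diag (Suc (Suc n)) F * K)))"
      using inv by (simp add: roots invariant_mset_def rho add_mset_commute)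
  qed
qed

section \<open>Orthonormal eigenbases of unitary operators\<close>

context hermitian_space
begin

lemma finite_dimensional_space: "finite_dimensional_vector_space scale (set some_basis)"
  using ordered_basis_some_basis by unfold_locales (auto simp: ordered_basis_def)

lemma herm_scale_right: "herm x (r *s y) = cnj r * herm x y"
  by (metis herm_scale herm_sym complex_cnj_mult)

lemma herm_zero_left [simp]: "herm 0 x = 0"
  using herm_scale[of 0 0 x] by simp

lemma herm_sum_left: "herm (sum f A) x = (\<Sum>a\<in>A. herm (f a) x)"
  by (induction A rule: infinite_finite_induct) (auto simp: herm_add)

lemma herm_diff_left: "herm (x - y) z = herm x z - herm y z"
  using herm_add[of "x - y" y z] by simp

lemma herm_self_eq_0_iff: "herm x x = 0 \<longleftrightarrow> x = 0"
proof
  assume "herm x x = 0"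
  thus "x = 0" using herm_pos[of x] by (cases "x = 0") simp_all
qed simp

lemma unitary_linear: "A \<in> unitary_group \<Longrightarrow> Vector_Spaces.linear scale scale A"
  by (simp add: unitary_group_def)

lemma unitary_herm: "A \<in> unitary_group \<Longrightarrow> herm (A x) (A y) = herm x y"
  by (simp add: unitary_group_def)

lemma unitary_eigenvalue:
  assumes "A \<in> unitary_group" "A v = l *s v" "v \<noteq> 0"
  shows "cmod l = 1"
proof -
  have "(l * cnj l) * herm v v = 1 * herm v v"
    using unitary_herm[OF assms(1), of v v]
    by (simp add: assms(2) herm_scale herm_scale_right mult_ac)
  hence "l * cnj l = 1"
    using assms(3) herm_self_eq_0_iff[of v] by (simp only: mult_cancel_right simp_thms)
  hence "complex_of_real ((cmod l)\<^sup>2) = 1"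
    by (simp only: complex_norm_square)
  hence "(cmod l)\<^sup>2 = 1"
    by (metis of_real_eq_1_iff)
  thus ?thesis
    using norm_ge_zero[of l] by (auto simp: power2_eq_1_iff)
qed

text \<open>
  An eigenvector is needed inside an invariant subspace, namely the orthogonal complement of the
  eigenvectors already found. Polynomials in the operator, applied to one vector of the subspace, produce
  it without restricting the operator or choosing a basis of the subspace.
\<close>

definition poly_op :: "complex poly \<Rightarrow> ('a \<Rightarrow> 'a) \<Rightarrow> 'a \<Rightarrow> 'a" where
  "poly_op p A v = (\<Sum>i\<le>degree p. coeff p i *s (A ^^ i) v)"

lemma poly_op_altdef:
  assumes "degree p \<le> n"
  shows "poly_op p A v = (\<Sum>i\<le>n. coeff p i *s (A ^^ i) v)"
  unfolding poly_op_def using assms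
  by (intro sum.mono_neutral_left) (auto simp: coeff_eq_0)

lemma poly_op_linear_factor:
  assumes "Vector_Spaces.linear scale scale A"
  shows "poly_op ([:- l, 1:] * q) A v = A (poly_op q A v) - l *s poly_op q A v"
proof -
  interpret A: Vector_Spaces.linear scale scale A by (rule assms)
  have "degree ([:- l, 1:] * q) \<le> Suc (degree q)"
    using degree_mult_le[of "[:- l, 1:]" q] by simp
  hence "poly_op ([:- l, 1:] * q) A v
      = (\<Sum>i\<le>Suc (degree q). coeff (pCons 0 q) i *s (A ^^ i) v - (l * coeff q i) *s (A ^^ i) v)"
    by (subst poly_op_altdef) (auto simp: scale_left_diff_distrib intro!: sum.cong)
  also have "\<dots> = (\<Sum>i\<le>Suc (degree q). coeff (pCons 0 q) i *s (A ^^ i) v)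
      - l *s (\<Sum>i\<le>Suc (degree q). coeff q i *s (A ^^ i) v)"
    by (simp add: sum_subtractf scale_sum_right del: sum.atMost_Suc)
  also have "(\<Sum>i\<le>Suc (degree q). coeff (pCons 0 q) i *s (A ^^ i) v) = A (poly_op q A v)"
    by (subst sum.atMost_Suc_shift) (simp add: poly_op_def A.sum A.scale)
  also have "(\<Sum>i\<le>Suc (degree q). coeff q i *s (A ^^ i) v) = poly_op q A v"
    by (simp add: poly_op_def coeff_eq_0)
  finally show ?thesis .
qed

text \<open>
  The \<open>dim + 1\<close> vectors \<open>v, A v, A\<^sup>2 v, ...\<close> satisfy a nontrivial linear relation. Two of these vectors
  may coincide, in which case they form too small a set to be dependent by counting, but their
  difference is a relation.
\<close>

lemma annihilating_poly_exists: "\<exists>p. p \<noteq> 0 \<and> poly_op p A v = 0"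
proof -
  interpret fd: finite_dimensional_vector_space scale "set some_basis"
    by (rule finite_dimensional_space)
  let ?n = "dim UNIV" and ?S = "(\<lambda>i. (A ^^ i) v) ` {..dim UNIV}"
  have "\<exists>u. (\<exists>i\<le>?n. u i \<noteq> 0) \<and> (\<Sum>i\<le>?n. u i *s (A ^^ i) v) = 0"
  proof (cases "inj_on (\<lambda>i. (A ^^ i) v) {..?n}")
    case True
    have "card ?S = Suc ?n" using card_image[OF True] by simp
    hence "dependent ?S"
      using fd.independent_card_le_dim[of ?S UNIV] by auto
    then obtain u where "\<exists>w\<in>?S. u w \<noteq> 0" "(\<Sum>w\<in>?S. u w *s w) = 0"
      by (auto simp: dependent_finite)
    moreover have "(\<Sum>w\<in>?S. u w *s w) = (\<Sum>i\<le>?n. u ((A ^^ i) v) *s (A ^^ i) v)"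
      by (simp only: sum.reindex[OF True] o_def)
    ultimately show ?thesis
      by (intro exI[of _ "\<lambda>i. u ((A ^^ i) v)"]) auto
  next
    case False
    then obtain i j where ij: "i \<le> ?n" "j \<le> ?n" "i \<noteq> j" "(A ^^ i) v = (A ^^ j) v"
      by (auto simp: inj_on_def)
    define u :: "nat \<Rightarrow> complex" where "u = (\<lambda>k. (if k = i then 1 else 0) - (if k = j then 1 else 0))"
    have "(\<Sum>k\<le>?n. u k *s (A ^^ k) v)
        = (\<Sum>k\<le>?n. if k = i then (A ^^ k) v else 0) - (\<Sum>k\<le>?n. if k = j then (A ^^ k) v else 0)"
      unfolding sum_subtractf[symmetric] by (intro sum.cong) (auto simp: u_def)
    also have "\<dots> = 0" using ij by simp
    finally show ?thesis using ij by (intro exI[of _ u]) (auto simp: u_def)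
  qed
  then obtain u i where u: "i \<le> ?n" "u i \<noteq> 0" "(\<Sum>i\<le>?n. u i *s (A ^^ i) v) = 0"
    by blast
  define p where "p = Poly (map u [0..<Suc ?n])"
  have coeff: "coeff p i = u i" if "i \<le> ?n" for i
    using that by (simp add: p_def nth_default_def del: upt_Suc)
  have "degree p \<le> ?n"
    by (rule degree_le) (auto simp: p_def nth_default_def simp del: upt_Suc)
  hence "poly_op p A v = 0"
    using u(3) by (simp add: poly_op_altdef coeff)
  moreover have "p \<noteq> 0" using coeff[OF u(1)] u(2) by auto
  ultimately show ?thesis by blast
qed

text \<open>
  If \<open>p\<close> has minimal degree among the nonzero polynomials with \<open>p(A) v = 0\<close> and \<open>p = (X - l) q\<close>, then
  \<open>q(A) v\<close> is nonzero by minimality and \<open>A - l\<close> kills it.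
\<close>

lemma eigenvector_in_invariant_subspace:
  assumes lin: "Vector_Spaces.linear scale scale A" and V: "subspace V"
    and inv: "\<And>v. v \<in> V \<Longrightarrow> A v \<in> V" and v: "v \<in> V" "v \<noteq> 0"
  obtains w l where "w \<in> V" "w \<noteq> 0" "A w = l *s w"
proof -
  let ?P = "\<lambda>p. p \<noteq> 0 \<and> poly_op p A v = 0"
  obtain p\<^sub>0 where "?P p\<^sub>0" using annihilating_poly_exists[of A v] by blast
  from ex_has_least_nat[of ?P, OF this, of degree]
  obtain p where p: "?P p" and min: "\<And>q. ?P q \<Longrightarrow> degree p \<le> degree q"
    by blast
  have "degree p > 0"
  proof (rule ccontr)
    assume "\<not> degree p > 0"
    then obtain a where "p = [:a:]" using degree_eq_zeroE by blast
    thus False using p v by (simp add: poly_op_def)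
  qed
  then obtain l where "poly p l = 0"
    using alg_closed_imp_poly_has_root by blast
  then obtain q where q: "p = [:- l, 1:] * q"
    by (auto simp: poly_eq_0_iff_dvd)
  have q0: "q \<noteq> 0" using p q by auto
  hence "degree p = Suc (degree q)"
    using q by (simp add: degree_mult_eq del: mult_pCons_left)
  hence "poly_op q A v \<noteq> 0"
    using min[of q] q0 by auto
  moreover have "(A ^^ i) v \<in> V" for i
    by (induction i) (auto simp: inv v)
  hence "poly_op q A v \<in> V"
    using V unfolding poly_op_def by (intro subspace_sum) (auto intro: subspace_scale)
  moreover have "A (poly_op q A v) = l *s poly_op q A v"
    using p poly_op_linear_factor[OF lin, of l q v] by (simp add: q del: mult_pCons_left)
  ultimately show thesis using that by blast
qed

definition orthonormal :: "'a set \<Rightarrow> bool" where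
  "orthonormal E \<longleftrightarrow> (\<forall>x\<in>E. \<forall>y\<in>E. herm x y = (if x = y then 1 else 0))"

lemma orthonormal_independent:
  assumes "orthonormal E"
  shows "independent E"
  unfolding independent_explicit_module
proof (intro allI impI)
  fix t u v
  assume t: "finite t" "t \<subseteq> E" "(\<Sum>w\<in>t. u w *s w) = 0" "v \<in> t"
  have "0 = herm (\<Sum>w\<in>t. u w *s w) v" by (simp add: t)
  also have "\<dots> = (\<Sum>w\<in>t. if w = v then u w else 0)"
    unfolding herm_sum_left herm_scale
    using assms t by (intro sum.cong) (auto simp: orthonormal_def subset_iff)
  also have "\<dots> = u v" using t by simp
  finally show "u v = 0" by simp
qed

text \<open>
  The orthogonal complement of a set of eigenvectors of a unitary operator is invariant, because
  \<open>\<langle>D x, D e\<rangle> = \<langle>x, e\<rangle> = 0\<close> and \<open>D e\<close> is a nonzero multiple of \<open>e\<close>. It is not \<open>0\<close> as long as the set does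
  not span, so it contains a further eigenvector.
\<close>

lemma extend_orthonormal_eigenvectors:
  assumes D: "D \<in> unitary_group" and E: "orthonormal E" "finite E" "span E \<noteq> UNIV"
    and eigen: "\<And>e. e \<in> E \<Longrightarrow> \<exists>l. D e = l *s e"
  obtains w where "w \<notin> E" "orthonormal (insert w E)" "\<exists>l. D w = l *s w"
proof -
  interpret D: Vector_Spaces.linear scale scale D by (rule unitary_linear[OF D])
  define V where "V = {v. \<forall>e\<in>E. herm v e = 0}"
  obtain u where u: "u \<notin> span E" using E by blast
  define v where "v = u - (\<Sum>e\<in>E. herm u e *s e)"
  have "herm v e = 0" if e: "e \<in> E" for e
  proof -
    have "herm (\<Sum>e\<in>E. herm u e *s e) e = (\<Sum>e'\<in>E. if e' = e then herm u e' else 0)"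
      unfolding herm_sum_left herm_scale
      using E e by (intro sum.cong) (auto simp: orthonormal_def)
    also have "\<dots> = herm u e" using E e by simp
    finally show ?thesis by (simp add: v_def herm_diff_left)
  qed
  hence "v \<in> V" by (simp add: V_def)
  moreover have "v \<noteq> 0"
  proof
    assume "v = 0"
    hence "u = (\<Sum>e\<in>E. herm u e *s e)" by (simp add: v_def)
    also have "\<dots> \<in> span E" by (intro span_sum span_scale span_base)
    finally show False using u by simp
  qed
  moreover have "subspace V"
    by (auto simp: subspace_def V_def herm_add herm_scale)
  moreover have "D x \<in> V" if x: "x \<in> V" for x
    unfolding V_def
  proof safe
    fix e assume e: "e \<in> E"
    then obtain l where l: "D e = l *s e" using eigen by blast
    have "herm e e = 1" using E(1) e by (simp add: orthonormal_def)
    hence "e \<noteq> 0" by auto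
    hence "l \<noteq> 0" using unitary_eigenvalue[OF D l] by auto
    have "cnj l * herm (D x) e = herm (D x) (D e)" by (simp add: l herm_scale_right)
    also have "\<dots> = 0" using x e by (simp add: unitary_herm[OF D] V_def)
    finally show "herm (D x) e = 0" using \<open>l \<noteq> 0\<close> by simp
  qed
  ultimately obtain w l where w: "w \<in> V" "w \<noteq> 0" "D w = l *s w"
    using eigenvector_in_invariant_subspace[OF unitary_linear[OF D], of V v] by blast
  define r where "r = complex_of_real (1 / sqrt (Re (herm w w)))"
  have pos: "herm w w \<in> \<real>" "Re (herm w w) > 0" using herm_pos w by auto
  have r: "cnj r = r" "r * r * herm w w = 1"
    using pos by (auto simp: r_def complex_is_Real_iff complex_eq_iff simp flip: of_real_mult)
  have "herm (r *s w) (r *s w) = 1"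
    using r by (simp add: herm_scale herm_scale_right mult.assoc)
  moreover have "herm (r *s w) e = 0" "herm e (r *s w) = 0" if "e \<in> E" for e
    using w that herm_sym[of e w] by (auto simp: V_def herm_scale herm_scale_right)
  ultimately have "r *s w \<notin> E" "orthonormal (insert (r *s w) E)"
    using E by (auto simp: orthonormal_def) 
  moreover have "D (r *s w) = l *s (r *s w)"
    by (simp add: D.scale w mult.commute)
  ultimately show thesis using that by blast
qed

text \<open>
  An orthonormal set of eigenvectors of maximal cardinality must span.
\<close>

lemma unitary_diagonalizable:
  assumes D: "D \<in> unitary_group"
  obtains bs where "ordered_basis bs" "orthonormal (set bs)" "\<And>b. b \<in> set bs \<Longrightarrow> \<exists>l. D b = l *s b"
proof -
  interpret fd: finite_dimensional_vector_space scale "set some_basis"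
    by (rule finite_dimensional_space)
  let ?P = "\<lambda>E. orthonormal E \<and> (\<forall>e\<in>E. \<exists>l. D e = l *s e)"
  have bound: "finite E \<and> card E \<le> dim UNIV" if "?P E" for E
    using that orthonormal_independent fd.independent_card_le_dim[of E UNIV] fd.finiteI_independent
    by blast
  have "?P {}" by (simp add: orthonormal_def)
  moreover have "\<forall>E. ?P E \<longrightarrow> card E < Suc (dim UNIV)" using bound by (simp add: less_Suc_eq_le)
  ultimately obtain E where E: "?P E" and max: "\<And>E'. ?P E' \<Longrightarrow> card E' \<le> card E"
    using ex_has_greatest_nat[of ?P "{}" card "Suc (dim UNIV)"] by blast
  have fin: "finite E" using bound E by blast
  have "span E = UNIV"
  proof (rule ccontr)
    assume "span E \<noteq> UNIV"
    then obtain w where w: "w \<notin> E" "orthonormal (insert w E)" "\<exists>l. D w = l *s w"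
      using extend_orthonormal_eigenvectors[OF D _ fin] E by metis
    hence "card (insert w E) \<le> card E" using max[of "insert w E"] E by auto
    thus False using w fin by simp
  qed
  moreover obtain bs where "set bs = E" "distinct bs"
    using finite_distinct_list[OF fin] by blast
  ultimately show thesis
    using that[of bs] E orthonormal_independent[of E] by (auto simp: ordered_basis_def)
qed

section \<open>Operators given by their matrix in an orthonormal basis\<close>

definition op_of_matrix :: "'a list \<Rightarrow> complex mat \<Rightarrow> 'a \<Rightarrow> 'a" where
  "op_of_matrix bs M v =
    (\<Sum>i<length bs. (\<Sum>j<length bs. M $$ (i, j) * herm v (bs ! j)) *s bs ! i)"

context
  fixes bs :: "'a list"
  assumes basis: "ordered_basis bs" and orthonormal: "orthonormal (set bs)"
begin

lemma herm_nth: "i < length bs \<Longrightarrow> j < length bs \<Longrightarrow> herm (bs ! i) (bs ! j) = (if i = j then 1 else 0)"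
  using basis orthonormal by (simp add: ordered_basis_def orthonormal_def nth_eq_iff_index_eq)

lemma herm_sum_nth:
  assumes "i < length bs"
  shows "herm (\<Sum>j<length bs. a j *s bs ! j) (bs ! i) = a i"
proof -
  have "herm (\<Sum>j<length bs. a j *s bs ! j) (bs ! i) = (\<Sum>j<length bs. if j = i then a j else 0)"
    unfolding herm_sum_left herm_scale using assms by (intro sum.cong) (simp_all add: herm_nth)
  thus ?thesis using assms by simp
qed

lemma representation_eq_herm:
  assumes "i < length bs"
  shows "representation (set bs) v (bs ! i) = herm v (bs ! i)"
  using herm_sum_nth[OF assms, of "\<lambda>j. representation (set bs) v (bs ! j)"]
  by (simp add: sum_ordered_basis[OF basis])

lemma orthonormal_expansion: "(\<Sum>i<length bs. herm v (bs ! i) *s bs ! i) = v"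
  using sum_ordered_basis[OF basis, of v] by (simp add: representation_eq_herm)

lemma coordinates_eqI:
  assumes "\<And>i. i < length bs \<Longrightarrow> herm v (bs ! i) = herm w (bs ! i)"
  shows "v = w"
proof -
  have "v = (\<Sum>i<length bs. herm v (bs ! i) *s bs ! i)"
    by (rule orthonormal_expansion[symmetric])
  also have "\<dots> = (\<Sum>i<length bs. herm w (bs ! i) *s bs ! i)"
    by (intro sum.cong) (simp_all add: assms)
  also have "\<dots> = w" by (rule orthonormal_expansion)
  finally show ?thesis .
qed

lemma herm_eq_sum: "herm v w = (\<Sum>i<length bs. herm v (bs ! i) * cnj (herm w (bs ! i)))"
proof -
  have "herm v w = herm (\<Sum>i<length bs. herm v (bs ! i) *s bs ! i) w"
    by (simp add: orthonormal_expansion)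
  also have "\<dots> = (\<Sum>i<length bs. herm v (bs ! i) * herm (bs ! i) w)"
    by (simp add: herm_sum_left herm_scale)
  finally show ?thesis using herm_sym[of _ w] by simp
qed

lemma herm_op_of_matrix:
  "i < length bs \<Longrightarrow> herm (op_of_matrix bs M v) (bs ! i) = (\<Sum>j<length bs. M $$ (i, j) * herm v (bs ! j))"
  unfolding op_of_matrix_def by (rule herm_sum_nth)

lemma linear_op_of_matrix: "Vector_Spaces.linear scale scale (op_of_matrix bs M)"
proof unfold_locales
  show "op_of_matrix bs M (x + y) = op_of_matrix bs M x + op_of_matrix bs M y" for x y
    by (rule coordinates_eqI) (simp add: herm_op_of_matrix herm_add algebra_simps sum.distrib)
  show "op_of_matrix bs M (r *s x) = r *s op_of_matrix bs M x" for r x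
    by (rule coordinates_eqI) (simp add: herm_op_of_matrix herm_scale sum_distrib_left mult.left_commute)
qed

lemma matrix_of_op_of_matrix:
  assumes "M \<in> carrier_mat (length bs) (length bs)"
  shows "matrix_of bs bs (op_of_matrix bs M) = M"
  using assms
  by (intro eq_matI) (auto simp: matrix_of_def representation_eq_herm herm_op_of_matrix herm_nth if_distrib[of "times _"] cong: if_cong)

lemma op_of_matrix_comp:
  assumes "M \<in> carrier_mat (length bs) (length bs)" "N \<in> carrier_mat (length bs) (length bs)"
  shows "op_of_matrix bs M \<circ> op_of_matrix bs N = op_of_matrix bs (M * N)"
proof
  fix v
  let ?n = "length bs"
  show "(op_of_matrix bs M \<circ> op_of_matrix bs N) v = op_of_matrix bs (M * N) v"
  proof (rule coordinates_eqI)
    fix i assume i: "i < ?n"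
    have "herm (op_of_matrix bs (M * N) v) (bs ! i)
        = (\<Sum>j<?n. \<Sum>k<?n. M $$ (i, k) * N $$ (k, j) * herm v (bs ! j))"
      using i assms by (simp add: herm_op_of_matrix scalar_prod_def sum_distrib_right atLeast0LessThan)
    also have "\<dots> = (\<Sum>k<?n. \<Sum>j<?n. M $$ (i, k) * N $$ (k, j) * herm v (bs ! j))"
      by (rule sum.swap)
    finally show "herm ((op_of_matrix bs M \<circ> op_of_matrix bs N) v) (bs ! i)
        = herm (op_of_matrix bs (M * N) v) (bs ! i)"
      using i by (simp add: herm_op_of_matrix sum_distrib_left mult.assoc)
  qed
qed

lemma op_of_matrix_one: "op_of_matrix bs (1\<^sub>m (length bs)) = id"
proof
  fix v
  have "(\<Sum>j<length bs. (1\<^sub>m (length bs)) $$ (i, j) * herm v (bs ! j)) = herm v (bs ! i)"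
    if "i < length bs" for i
  proof -
    have "(\<Sum>j<length bs. (1\<^sub>m (length bs)) $$ (i, j) * herm v (bs ! j)) = (\<Sum>j<length bs. if j = i then herm v (bs ! j) else 0)"
      using that by (intro sum.cong) auto
    thus ?thesis using that by simp
  qed
  thus "op_of_matrix bs (1\<^sub>m (length bs)) v = id v"
    by (intro coordinates_eqI) (simp add: herm_op_of_matrix)
qed

lemma op_of_matrix_adjoint:
  assumes "\<And>i j. i < length bs \<Longrightarrow> j < length bs \<Longrightarrow> N $$ (i, j) = cnj (M $$ (j, i))"
  shows "herm (op_of_matrix bs M v) w = herm v (op_of_matrix bs N w)"
proof -
  let ?n = "length bs"
  have "herm (op_of_matrix bs M v) w
      = (\<Sum>i<?n. \<Sum>j<?n. M $$ (i, j) * herm v (bs ! j) * cnj (herm w (bs ! i)))"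
    by (subst herm_eq_sum) (simp add: herm_op_of_matrix sum_distrib_right)
  also have "\<dots> = (\<Sum>j<?n. \<Sum>i<?n. M $$ (i, j) * herm v (bs ! j) * cnj (herm w (bs ! i)))"
    by (rule sum.swap)
  also have "\<dots> = herm v (op_of_matrix bs N w)"
    by (subst herm_eq_sum) (simp add: herm_op_of_matrix sum_distrib_left assms mult_ac)
  finally show ?thesis .
qed

text \<open>
  \<open>N\<close> is the adjoint matrix of \<open>M\<close>, so the hypotheses on the products say that \<open>M\<close> is a unitary matrix.
\<close>

lemma op_of_matrix_unitary:
  assumes M: "M \<in> carrier_mat (length bs) (length bs)" and N: "N \<in> carrier_mat (length bs) (length bs)"
    and adj: "\<And>i j. i < length bs \<Longrightarrow> j < length bs \<Longrightarrow> N $$ (i, j) = cnj (M $$ (j, i))"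
    and inv: "M * N = 1\<^sub>m (length bs)" "N * M = 1\<^sub>m (length bs)"
  shows "op_of_matrix bs M \<in> unitary_group"
proof -
  have 1: "op_of_matrix bs N \<circ> op_of_matrix bs M = id" "op_of_matrix bs M \<circ> op_of_matrix bs N = id"
    using M N by (simp_all add: op_of_matrix_comp inv op_of_matrix_one)
  hence "bij (op_of_matrix bs M)" by (rule o_bij)
  moreover have "herm (op_of_matrix bs M x) (op_of_matrix bs M y) = herm x y" for x y
    using op_of_matrix_adjoint[OF adj, of x "op_of_matrix bs M y"] 1(1) by (simp add: fun_eq_iff)
  ultimately show ?thesis
    using linear_op_of_matrix by (simp add: unitary_group_def)
qed

lemma eq_op_of_diagonal_matrix:
  assumes "Vector_Spaces.linear scale scale A" and "\<And>i. i < length bs \<Longrightarrow> A (bs ! i) = d i *s bs ! i"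
  shows "A = op_of_matrix bs (mat_diag (length bs) d)"
proof
  fix v
  interpret A: Vector_Spaces.linear scale scale A by (rule assms)
  let ?n = "length bs"
  show "A v = op_of_matrix bs (mat_diag ?n d) v"
  proof (rule coordinates_eqI)
    fix i assume i: "i < ?n"
    have "A v = A (\<Sum>j<?n. herm v (bs ! j) *s bs ! j)" by (simp add: orthonormal_expansion)
    also have "\<dots> = (\<Sum>j<?n. (herm v (bs ! j) * d j) *s bs ! j)"
      by (simp add: A.sum A.scale assms)
    finally have "herm (A v) (bs ! i) = d i * herm v (bs ! i)"
      using i by (simp add: herm_sum_nth)
    also have "\<dots> = (\<Sum>j<?n. if j = i then d j * herm v (bs ! j) else 0)"
      using i by simp
    also have "\<dots> = (\<Sum>j<?n. mat_diag ?n d $$ (i, j) * herm v (bs ! j))"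
      using i by (intro sum.cong) (auto simp: mat_diag_def)
    finally show "herm (A v) (bs ! i) = herm (op_of_matrix bs (mat_diag ?n d) v) (bs ! i)"
      using i by (simp add: herm_op_of_matrix)
  qed
qed

end

section \<open>Determinant and spectrum of operators\<close>

lemma op_det_comp:
  assumes "Vector_Spaces.linear scale scale A" "Vector_Spaces.linear scale scale B"
  shows "op_det (A \<circ> B) = op_det A * op_det B"
  unfolding op_det_def
  by (simp add: matrix_of_comp[OF ordered_basis_some_basis ordered_basis_some_basis ordered_basis_some_basis assms(1)]
      det_mult[OF matrix_of_carrier matrix_of_carrier] ordered_basis_some_basis)

lemma op_det_id: "op_det id = 1"
  by (simp add: op_det_def matrix_of_id ordered_basis_some_basis)

lemma op_det_unitary_nonzero:
  assumes A: "A \<in> unitary_group"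
  shows "op_det A \<noteq> 0"
proof -
  interpret fd: finite_dimensional_vector_space scale "set some_basis"
    by (rule finite_dimensional_space)
  have bij: "bij A" and lin: "Vector_Spaces.linear scale scale A" using A by (auto simp: unitary_group_def)
  obtain B where B: "B \<circ> A = id"
    using bij_is_inj[OF bij] by (auto simp: inj_iff)
  hence "Vector_Spaces.linear scale scale B"
    by (rule fd.left_inverse_linear[OF lin])
  with B have "op_det B * op_det A = 1"
    using op_det_comp lin op_det_id by metis
  thus ?thesis by auto
qed

lemma prod_mset_op_spec: "prod_mset (op_spec A) = op_det A"
  unfolding op_spec_def op_char_poly_def op_det_def
  by (rule prod_mset_proots_char_poly[OF matrix_of_carrier]) (rule ordered_basis_some_basis)+

lemma size_op_spec: "size (op_spec A) = dim UNIV"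
  unfolding op_spec_def op_char_poly_def
  using degree_monic_char_poly[OF matrix_of_carrier[OF ordered_basis_some_basis ordered_basis_some_basis, of A]]
  by (simp add: size_proots_complex)

end

section \<open>The equivalence\<close>

text \<open>
  Applying \<open>\<rho>\<close> to all members of a multiset of \<open>k\<close> nonzero numbers with product \<open>P\<close> gives a multiset with product
  \<open>c\<^bsup>2k\<^esup> / P\<close>, which invariance equates with \<open>P\<close>.
\<close>

lemma invariant_mset_rho_prod:
  assumes inv: "invariant_mset (rho c) M" and nz: "prod_mset M \<noteq> 0"
  shows "(prod_mset M)\<^sup>2 = c ^ (2 * size M)"
proof -
  have "prod_mset (image_mset (rho c) N) * prod_mset N = c ^ (2 * size N)" if "0 \<notin># N" for N
    using that by (induction N) (auto simp: rho_def field_simps power2_eq_square)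
  from this[of M] show ?thesis
    using inv nz by (simp add: invariant_mset_def power2_eq_square)
qed

context hermitian_space
begin

lemma det_condition_necessary:
  assumes FK: "F \<in> unitary_group" "K \<in> unitary_group" and K: "K \<circ> K = id" and p: "p \<noteq> 0"
    and inv: "invariant_mset (rho c) ({#p#} + op_spec (F \<circ> K))"
  shows "p\<^sup>2 * op_det (F \<circ> F) = c ^ (2 * (dim UNIV + 1))"
proof -
  note lin = FK[THEN unitary_linear]
  have "op_det K * op_det K = 1"
    using op_det_comp[OF lin(2) lin(2)] by (simp add: K op_det_id)
  hence "p\<^sup>2 * op_det (F \<circ> F) = (p * op_det (F \<circ> K))\<^sup>2"
    using op_det_comp[OF lin(1) lin(1)] op_det_comp[OF lin(1) lin(2)]
    by (simp add: power2_eq_square mult_ac)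
  also have "p * op_det (F \<circ> K) = prod_mset ({#p#} + op_spec (F \<circ> K))"
    by (simp add: prod_mset_op_spec)
  also have "\<dots>\<^sup>2 = c ^ (2 * size ({#p#} + op_spec (F \<circ> K)))"
  proof (rule invariant_mset_rho_prod[OF inv])
    show "prod_mset ({#p#} + op_spec (F \<circ> K)) \<noteq> 0"
      using p FK by (simp add: prod_mset_op_spec op_det_comp[OF lin] op_det_unitary_nonzero)
  qed
  also have "size ({#p#} + op_spec (F \<circ> K)) = dim UNIV + 1"
    by (simp only: size_union size_single size_op_spec add.commute)
  finally show ?thesis .
qed

text \<open>
  In an orthonormal eigenbasis of \<open>D\<close> the operators with the matrices of
  \<open>diagonal_square_root_times_involution\<close> have all the required properties. The diagonal matrix is unitary because
  a square root of a number on the unit circle lies on the unit circle.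
\<close>

lemma det_condition_sufficient:
  assumes D: "D \<in> unitary_group" and p: "cmod p = 1" and c: "cmod c = 1"
    and det: "p\<^sup>2 * op_det D = c ^ (2 * (dim UNIV + 1))"
  shows "\<exists>F\<in>unitary_group. \<exists>K\<in>unitary_group. K \<circ> K = id \<and> F \<circ> F = D \<and>
    invariant_mset (rho c) ({#p#} + op_spec (F \<circ> K))"
proof -
  obtain bs where basis: "ordered_basis bs" and on: "orthonormal (set bs)"
    and eigen: "\<And>b. b \<in> set bs \<Longrightarrow> \<exists>l. D b = l *s b"
    using unitary_diagonalizable[OF D] by blast
  define n where "n = length bs"
  have n: "n = dim UNIV" by (simp add: n_def length_ordered_basis[OF basis])
  note on_basis = basis on
  have "\<forall>i. \<exists>l. i < n \<longrightarrow> D (bs ! i) = l *s bs ! i"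
    using eigen by (simp add: n_def)
  from choice[OF this] obtain d where d: "\<And>i. i < n \<Longrightarrow> D (bs ! i) = d i *s bs ! i"
    by blast
  have d1: "cmod (d i) = 1" if "i < n" for i
  proof (rule unitary_eigenvalue[OF D d[OF that]])
    show "bs ! i \<noteq> 0"
      using herm_nth[OF on_basis, of i i] that by (auto simp: n_def)
  qed
  have D_eq: "D = op_of_matrix bs (mat_diag n d)"
    unfolding n_def
    by (rule eq_op_of_diagonal_matrix[OF on_basis unitary_linear[OF D]]) (simp add: d n_def)
  have "op_det D = det (mat_diag n d)"
    using op_det_eq[OF basis unitary_linear[OF D]] matrix_of_op_of_matrix[OF on_basis, of "mat_diag n d"]
    by (simp add: D_eq n_def)
  also have "\<dots> = (\<Prod>i<n. d i)"
    by (subst det_upper_triangular[of _ n])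
      (auto simp: mat_diag_def prod_list_diag_prod atLeast0LessThan intro!: prod.cong)
  finally have "p\<^sup>2 * (\<Prod>i<n. d i) = c ^ (2 * (n + 1))"
    using det by (simp add: n)
  from diagonal_square_root_times_involution[OF d1 p c this]
  obtain f K where f: "\<And>i. i < n \<Longrightarrow> (f i)\<^sup>2 = d i" and K: "K \<in> carrier_mat n n" "K * K = 1\<^sub>m n"
    and self_adj: "\<And>i j. i < n \<Longrightarrow> j < n \<Longrightarrow> K $$ (i, j) = cnj (K $$ (j, i))"
    and inv: "invariant_mset (rho c) ({#p#} + proots (char_poly (mat_diag n f * K)))"
    by blast
  have f1: "f i * cnj (f i) = 1" if "i < n" for i
  proof -
    have "(cmod (f i))\<^sup>2 = 1" using d1[OF that] f[OF that] by (simp add: norm_power[symmetric])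
    thus ?thesis by (simp add: complex_norm_square[symmetric] del: of_real_power)
  qed
  let ?F = "op_of_matrix bs (mat_diag n f)" and ?K = "op_of_matrix bs K"
  have diag_one: "mat_diag n g = 1\<^sub>m n" if "\<And>i. i < n \<Longrightarrow> g i = 1" for g :: "nat \<Rightarrow> complex"
    using that by (intro eq_matI) (auto simp: mat_diag_def)
  have "?F \<in> unitary_group"
  proof (rule op_of_matrix_unitary[OF on_basis, folded n_def])
    show "mat_diag n (\<lambda>i. cnj (f i)) $$ (i, j) = cnj (mat_diag n f $$ (j, i))" if "i < n" "j < n" for i j
      using that by (simp add: mat_diag_def)
  qed (auto simp: f1 mult.commute[of "cnj _"] intro!: diag_one)
  moreover have "?K \<in> unitary_group"
    by (rule op_of_matrix_unitary[OF on_basis, folded n_def, OF K(1) K(1) self_adj K(2) K(2)])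
  moreover have "?K \<circ> ?K = id"
    using op_of_matrix_comp[OF on_basis, folded n_def, OF K(1) K(1)] op_of_matrix_one[OF on_basis, folded n_def]
    by (simp add: K)
  moreover have "?F \<circ> ?F = D"
  proof -
    have "mat_diag n (\<lambda>i. f i * f i) = mat_diag n d"
      by (intro eq_matI) (auto simp: mat_diag_def f[symmetric] power2_eq_square)
    thus ?thesis
      by (simp add: op_of_matrix_comp[OF on_basis, folded n_def] D_eq)
  qed
  moreover have "op_spec (?F \<circ> ?K) = proots (char_poly (mat_diag n f * K))"
  proof -
    have FK: "mat_diag n f * K \<in> carrier_mat n n"
      using mat_diag_dim K(1) by (rule mult_carrier_mat)
    have "?F \<circ> ?K = op_of_matrix bs (mat_diag n f * K)"
      by (rule op_of_matrix_comp[OF on_basis, folded n_def, OF mat_diag_dim K(1)])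
    thus ?thesis
      unfolding op_spec_def
      using op_char_poly_eq[OF basis linear_op_of_matrix[OF on_basis, of "mat_diag n f * K"]]
      by (simp add: matrix_of_op_of_matrix[OF on_basis, folded n_def, OF FK])
  qed
  ultimately show ?thesis
    using inv by (intro bexI[of _ ?F] bexI[of _ ?K] conjI) simp_all
qed

end

theorem proposition4p8:
  fixes scale :: "complex \<Rightarrow> 'a::ab_group_add \<Rightarrow> 'a"
    and herm :: "'a \<Rightarrow> 'a \<Rightarrow> complex"
    and D :: "'a \<Rightarrow> 'a"
    and p c :: complex
    and m :: nat
  assumes "hermitian_space scale herm"
    and "vector_space.dim scale (UNIV :: 'a set) = m"
    and "D \<in> hermitian_space.unitary_group scale herm"
    and "cmod p = 1" and "cmod c = 1"
  shows "p\<^sup>2 * hermitian_space.op_det scale D = c ^ (2 * (m + 1)) \<longleftrightarrow>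
    (\<exists>F \<in> hermitian_space.unitary_group scale herm.
     \<exists>K \<in> hermitian_space.unitary_group scale herm.
       K \<circ> K = id \<and> F \<circ> F = D \<and>
       invariant_mset (rho c) ({#p#} + hermitian_space.op_spec scale (F \<circ> K)))"
proof -
  interpret hermitian_space scale herm by (rule assms(1))
  have "p \<noteq> 0" using assms(4) by auto
  show ?thesis
    using det_condition_sufficient[OF assms(3-5)] det_condition_necessary[OF _ _ _ \<open>p \<noteq> 0\<close>]
    unfolding assms(2) by blast
qed

end
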